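(* Let $A$ be the Conway sequence: $A(1)=A(2)=1$ and $A(n)=A(n-A(n-1))+A(A(n-1))$ for $n\ge3$. Define the maternal generation sequence $M_1$ by $M_1(1)=M_1(2)=1$ and $M_1(n)=M_1(n-A(n-1))+1$ for $n\ge 3$, and let $\alpha_1(g)=\min\{n: M_1(n)=g\}$. Then $\alpha_1(g)=2^{g-1}+1$ for all $g>1$.
   Context: $M_1$ is the generation sequence of $A$ based on the spot function $S_1(n)=n-A(n-1)$; $\alpha_1(g)$ is the beginning of the $g$-th maternal generation. *)

theory Defs
  imports Main
begin

text \<open>The sequences are indexed from 1; the value at 0 is a dummy and is never reached by the
  recursions, by the bounds \<open>1 \<le> conway n \<le> n\<close> for \<open>n \<ge> 1\<close>. For the same reason the truncated
  subtractions on \<^typ>\<open>nat\<close> below agree with the integer ones.\<close>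

function conway :: "nat \<Rightarrow> nat" where
  "conway 0 = 0"
| "conway 1 = 1"
| "conway 2 = 1"
| "n \<ge> 3 \<Longrightarrow> conway n = conway (n - conway (n - 1)) + conway (conway (n - 1))"
  by (atomize_elim, presburger) simp_all

lemma conway_dom_bounds:
  assumes "conway_dom n" "n \<ge> 1"
  shows "1 \<le> conway n \<and> conway n \<le> n"
  using assms
proof (induction n rule: conway.pinduct)
  case (4 n)
  let ?a = "conway (n - 1)"
  have "1 \<le> n - 1"
    using \<open>3 \<le> n\<close> by linarith
  then have a: "1 \<le> ?a \<and> ?a \<le> n - 1"
    by (rule "4.IH"(1))
  then have "1 \<le> n - ?a"
    using \<open>3 \<le> n\<close> by linarith
  then have "1 \<le> conway (n - ?a) \<and> conway (n - ?a) \<le> n - ?a"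
    by (rule "4.IH"(2))
  moreover have "1 \<le> conway ?a \<and> conway ?a \<le> ?a"
    using a by (intro "4.IH"(4)) simp
  moreover have "conway n = conway (n - ?a) + conway ?a"
    by (rule conway.psimps(4)) fact+
  ultimately show ?case
    using a by linarith
next
  case 1
  then show ?case by linarith
next
  case 2
  have "conway 1 = 1"
    by (rule conway.psimps(2)) fact
  then show ?case by linarith
next
  case 3
  have "conway 2 = 1"
    by (rule conway.psimps(3)) fact
  then show ?case by linarith
qed

lemma conway_total: "All conway_dom"
proof (rule conway.termination[of "measure (\<lambda>n. n)"])
  fix n :: nat
  assume n: "3 \<le> n"
  assume "conway_dom (n - 1)"
  then have "1 \<le> conway (n - 1) \<and> conway (n - 1) \<le> n - 1"
    using n by (intro conway_dom_bounds) linarith+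
  then have "n - conway (n - 1) < n" "conway (n - 1) < n"
    using n by linarith+
  then show "(n - conway (n - 1), n) \<in> measure (\<lambda>n. n)"
    "(conway (n - 1), n) \<in> measure (\<lambda>n. n)"
    by simp_all
qed simp_all

termination conway
  by (rule conway_total)

declare conway.simps(4) [simp del]

lemma conway_bounds: "n \<ge> 1 \<Longrightarrow> 1 \<le> conway n \<and> conway n \<le> n"
  by (rule conway_dom_bounds[OF conway_total[THEN spec]])

function maternal_gen :: "nat \<Rightarrow> nat" where
  "maternal_gen 0 = 0"
| "maternal_gen 1 = 1"
| "maternal_gen 2 = 1"
| "n \<ge> 3 \<Longrightarrow> maternal_gen n = maternal_gen (n - conway (n - 1)) + 1"
  by (atomize_elim, presburger) simp_all

termination maternal_gen
proof (relation "measure (\<lambda>n. n)")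
  fix n :: nat
  assume n: "3 \<le> n"
  then have "1 \<le> conway (n - 1)"
    using conway_bounds[of "n - 1"] by linarith
  then have "n - conway (n - 1) < n"
    using n by linarith
  then show "(n - conway (n - 1), n) \<in> measure (\<lambda>n. n)"
    by simp
qed simp

declare maternal_gen.simps(4) [simp del]

definition maternal_start :: "nat \<Rightarrow> nat" where
  "maternal_start g = (LEAST n. n \<ge> 1 \<and> maternal_gen n = g)"

end

theory Submission
  imports Defs
begin

text \<open>The Conway sequence \<open>A\<close> satisfies \<open>A(n) \<ge> n/2\<close>, and its increments are 0 or 1. These two
  facts give \<open>A(2\<^sup>k\<^sup>+\<^sup>1) = 2\<^sup>k\<close>: once \<open>A(n - 1)\<close> has reached \<open>N = 2\<^sup>k\<close>, the
  recursion reads \<open>A(n) = A(n - N) + A(N) \<le> 2 A(N) = N\<close> as long as \<open>n \<le> 2 N\<close>. Hence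
  the spot function \<open>n - A(n - 1)\<close> maps \<open>2\<^sup>g + 1\<close> to \<open>2\<^sup>g\<^sup>-\<^sup>1 + 1\<close>, while \<open>A(n) \<ge> n/2\<close> shows that
  it maps every \<open>n \<le> 2\<^sup>g\<close> to at most \<open>2\<^sup>g\<^sup>-\<^sup>1\<close>.\<close>

text \<open>The two arguments \<open>n - a\<close> and \<open>a\<close> of the recursion add up to
  \<open>n\<close>, so a linear lower bound passes through it by strong induction.\<close>

lemma conway_ge_half: "n \<le> 2 * conway n"
proof (induction n rule: less_induct)
  case (less n)
  consider "n = 0" | "n = 1" | "n = 2" | "n \<ge> 3" by linarith
  then show ?case
  proof cases
    case 4
    define a where "a = conway (n - 1)"
    have a: "1 \<le> a" "a \<le> n - 1"
      using conway_bounds[of "n - 1"] 4 by (auto simp: a_def)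
    have "conway n = conway (n - a) + conway a"
      using conway.simps(4)[OF 4] by (simp add: a_def)
    moreover have "n - a \<le> 2 * conway (n - a)" "a \<le> 2 * conway a"
      using less.IH[of "n - a"] less.IH[of a] a 4 by auto
    ultimately show ?thesis by linarith
  qed (use conway.simps(2) in auto)
qed

text \<open>From \<open>n\<close> to \<open>Suc n\<close> exactly one of the two arguments in the
  recursion grows by 1 and the other stays: the step of \<open>conway\<close> at
  \<open>n - 1\<close> decides which.\<close>

lemma conway_Suc_cases:
  assumes "n \<ge> 1"
  shows "conway (Suc n) = conway n \<or> conway (Suc n) = Suc (conway n)"
  using assms
proof (induction n rule: less_induct)
  case (less n)
  show ?case
  proof (cases "n \<le> 2")
    case True
    have "conway 3 = 2"
      using conway.simps(4)[of 3] conway.simps(2,3) by simp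
    moreover have "n = 1 \<or> n = 2" using True less.prems by linarith
    moreover have "conway 1 = 1" "conway 2 = 1" "Suc 1 = 2" "Suc 2 = 3"
      using conway.simps(2,3) by simp_all
    ultimately show ?thesis by metis
  next
    case False
    define a where "a = conway (n - 1)"
    have a: "1 \<le> a" "a \<le> n - 1"
      using conway_bounds[of "n - 1"] False by (auto simp: a_def)
    have rec_n: "conway n = conway (n - a) + conway a"
      using conway.simps(4)[of n] False by (simp add: a_def)
    have rec_Suc: "conway (Suc n) = conway (Suc n - conway n) + conway (conway n)"
      using conway.simps(4)[of "Suc n"] False by simp
    have "conway n = a \<or> conway n = Suc a"
      using less.IH[of "n - 1"] False by (simp add: a_def)
    then show ?thesis
    proof
      assume eq: "conway n = a"
      have "conway (Suc n) = conway (Suc (n - a)) + conway a"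
        using rec_Suc eq a by (simp add: Suc_diff_le)
      then show ?thesis
        using less.IH[of "n - a"] a False rec_n by auto
    next
      assume eq: "conway n = Suc a"
      have "conway (Suc n) = conway (n - a) + conway (Suc a)"
        using rec_Suc eq by simp
      then show ?thesis
        using less.IH[of a] a False rec_n by auto
    qed
  qed
qed

lemma conway_mono: "m \<le> n \<Longrightarrow> conway m \<le> conway n"
proof (induction n rule: dec_induct)
  case (step n)
  show ?case
  proof (cases "n = 0")
    case False
    then show ?thesis
      using conway_Suc_cases[of n] step.IH by auto
  qed (use step in auto)
qed simp

lemma conway_le_of_double:
  assumes "2 * conway N \<le> N" "N \<ge> 1" "n \<le> 2 * N"
  shows "conway n \<le> N"
  using assms(3)
proof (induction n)
  case (Suc n)
  show ?case
  proof (cases "n \<ge> 2")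
    case True
    \<comment> \<open>With increments of at most 1, the value cannot jump over \<open>N\<close>;
      only the case where it sits at \<open>N\<close> needs the recursion.\<close>
    consider "conway n < N" | "conway n = N" using Suc by linarith
    then show ?thesis
    proof cases
      case 1
      then show ?thesis using conway_Suc_cases[of n] True by linarith
    next
      case 2
      have "conway (Suc n) = conway (Suc n - N) + conway N"
        using conway.simps(4)[of "Suc n"] True 2 by simp
      moreover have "conway (Suc n - N) \<le> conway N"
        using Suc.prems by (intro conway_mono) linarith
      ultimately show ?thesis using assms(1) by linarith
    qed
  next
    case False
    have "conway (Suc n) \<le> conway 2" using False by (intro conway_mono) simp
    then show ?thesis using assms(2) by simp
  qed
qed simp

lemma conway_power2: "conway (2 ^ Suc k) = 2 ^ k"
proof (induction k)
  case (Suc k)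
  have "conway (2 ^ Suc (Suc k)) \<le> 2 ^ Suc k"
    by (rule conway_le_of_double) (use Suc in auto)
  moreover have "2 ^ Suc k \<le> conway (2 ^ Suc (Suc k))"
    using conway_ge_half[of "2 ^ Suc (Suc k)"] by simp
  ultimately show ?case by (rule antisym)
qed simp

lemma maternal_gen_le: "n \<le> 2 ^ Suc g \<Longrightarrow> maternal_gen n \<le> Suc g"
proof (induction g arbitrary: n)
  case 0
  then have "n = 0 \<or> n = 1 \<or> n = 2" by auto
  then show ?case using maternal_gen.simps(1-3) by auto
next
  case (Suc g)
  show ?case
  proof (cases "n \<ge> 3")
    case True
    \<comment> \<open>The half bound gives only (n + 1)/2; the excess 1/2 is lost to rounding, since
      the bound on \<open>n\<close> is even.\<close>
    have "n - conway (n - 1) \<le> 2 ^ Suc g"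
      using conway_ge_half[of "n - 1"] Suc.prems by simp
    then show ?thesis
      using Suc.IH maternal_gen.simps(4)[OF True] by simp
  next
    case False
    then have "n = 0 \<or> n = 1 \<or> n = 2" by auto
    then show ?thesis using maternal_gen.simps(1-3) by auto
  qed
qed

text \<open>For \<open>g = 0\<close> the point is 2, which lies in generation 1 but does not begin
  it; hence \<open>g > 1\<close> in the theorem.\<close>

lemma maternal_gen_power2_plus_1: "maternal_gen (2 ^ g + 1) = Suc g"
proof (induction g)
  case 0
  have "(2::nat) ^ 0 + 1 = 2" by simp
  then show ?case by (simp only: maternal_gen.simps(3))
next
  case (Suc g)
  have "3 \<le> (2::nat) ^ Suc g + 1" by simp
  moreover have "(2::nat) ^ Suc g + 1 - conway (2 ^ Suc g + 1 - 1) = 2 ^ g + 1"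
    using conway_power2[of g] by simp
  ultimately show ?case
    using maternal_gen.simps(4)[of "2 ^ Suc g + 1"] Suc.IH by simp
qed

theorem proposition1:
  fixes g :: nat
  assumes "g > 1"
  shows "maternal_start g = 2 ^ (g - 1) + 1"
proof -
  \<comment> \<open>\<open>maternal_gen_le\<close> speaks of positive exponents, so
    \<open>g - 1\<close> is written as \<open>Suc h\<close>.\<close>
  define h where "h = g - 2"
  then have g: "g = Suc (Suc h)" using assms by simp
  show ?thesis
    unfolding maternal_start_def
  proof (rule Least_equality)
    show "1 \<le> (2::nat) ^ (g - 1) + 1 \<and> maternal_gen (2 ^ (g - 1) + 1) = g"
      using maternal_gen_power2_plus_1[of "Suc h"] g by simp
  next
    fix n :: nat
    assume n: "1 \<le> n \<and> maternal_gen n = g"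
    show "2 ^ (g - 1) + 1 \<le> n"
    proof (rule ccontr)
      assume "\<not> 2 ^ (g - 1) + 1 \<le> n"
      then have "n \<le> 2 ^ Suc h" using g by simp
      then show False using maternal_gen_le[of n h] n g by simp
    qed
  qed
qed

end
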